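(* Let $\mathcal{T}$ be a $\vec{\chi}$-bounded class of tournaments. Then $\mathcal{T}$ has the $BIG\Rightarrow BIG$ property: there exists a function $f$ such that, for every $t$ and every $T\in\mathcal{T}$, if $\vec{\chi}(T)\ge f(t)$, then $T$ contains two disjoint subtournaments $A$ and $B$ such that $\vec{\chi}(A)\ge t$, $\vec{\chi}(B)\ge t$ and $A\Rightarrow B$.
   Context: All graphs and digraphs are finite, with no loops, no parallel edges or arcs, and no anti-parallel arcs. A tournament is an orientation of a complete graph. A class of tournaments is a set of tournaments closed under taking subtournaments (and isomorphism). The dichromatic number $\vec{\chi}(D)$ of a digraph $D$ is the least $k$ such that $V(D)$ can be partitioned into $k$ sets each inducing an acyclic subdigraph. For a total ordering $\prec$ of $V(D)$, the backedge graph $D^{\prec}$ is the undirected graph with vertex set $V(D)$ in which, for $u\prec v$, $uv$ is an edge if and only if $vu\in A(D)$. The clique number of $D$ is $\vec{\omega}(D)=\min\{\omega(D^{\prec}) : \prec \text{ a total ordering of } V(D)\}$. A class $\mathcal{C}$ is $\vec{\chi}$-bounded if there is an increasing function $h$ with $\vec{\chi}(D)\le h(\vec{\omega}(D))$ for every $D\in\mathcal{C}$. For vertex-disjoint subtournaments $A,B$ of $T$, $A\Rightarrow B$ means $ab\in A(T)$ (the arc set of $T$) for every vertex $a$ of $A$ and every vertex $b$ of $B$. *)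

theory Defs
  imports
    "Graph_Theory.Pair_Digraph"
    "Graph_Theory.Digraph_Component"
    "Graph_Theory.Digraph_Isomorphism"
    "HOL-Library.Ramsey"
    "HOL-Library.Disjoint_Sets"
begin

text \<open>
  Arcs of a \<open>pair_pre_digraph\<close> are pairs of vertices, so parallel arcs cannot occur;
  \<open>pair_digraph\<close> provides finiteness and excludes loops. Digraphs may be null.
\<close>

definition oriented_digraph :: "'a pair_pre_digraph \<Rightarrow> bool" where
  "oriented_digraph D \<longleftrightarrow> pair_digraph D \<and> (\<forall>(u, v) \<in> parcs D. (v, u) \<notin> parcs D)"

definition tournament :: "'a pair_pre_digraph \<Rightarrow> bool" where
  "tournament T \<longleftrightarrow> oriented_digraph T \<and>
     (\<forall>u \<in> pverts T. \<forall>v \<in> pverts T. u \<noteq> v \<longrightarrow> (u, v) \<in> parcs T \<or> (v, u) \<in> parcs T)"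

definition subtournament :: "'a pair_pre_digraph \<Rightarrow> 'a pair_pre_digraph \<Rightarrow> bool" where
  "subtournament A T \<longleftrightarrow> tournament A \<and> subgraph (with_proj A) (with_proj T)"

definition tournament_class :: "'a pair_pre_digraph set \<Rightarrow> bool" where
  "tournament_class C \<longleftrightarrow>
     (\<forall>T \<in> C. tournament T) \<and>
     (\<forall>T \<in> C. \<forall>A. subtournament A T \<longrightarrow> A \<in> C) \<and>
     (\<forall>T \<in> C. \<forall>T'. digraph_iso (with_proj T) (with_proj T') \<longrightarrow> T' \<in> C)"

text \<open>
  \<open>partition_on\<close> requires nonempty parts, which does not change the least number
  of parts; the null digraph has dichromatic number 0.
\<close>

definition dichromatic_number :: "'a pair_pre_digraph \<Rightarrow> nat" where
  "dichromatic_number D =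
     (LEAST k. \<exists>P. partition_on (pverts D) P \<and> finite P \<and> card P = k \<and>
        (\<forall>X \<in> P. acyclic (Restr (parcs D) X)))"

text \<open>
  Total orderings are reflexive relations \<open>r\<close>; the strict order is
  \<open>(u, v) \<in> r \<and> u \<noteq> v\<close>.
\<close>

definition backedges :: "'a pair_pre_digraph \<Rightarrow> 'a rel \<Rightarrow> 'a set set" where
  "backedges D r = {{u, v} | u v. (u, v) \<in> r \<and> u \<noteq> v \<and> (v, u) \<in> parcs D}"

definition graph_clique_number :: "'a set \<Rightarrow> 'a set set \<Rightarrow> nat" where
  "graph_clique_number V E = Max {card K | K. K \<subseteq> V \<and> clique K E}"

definition clique_number :: "'a pair_pre_digraph \<Rightarrow> nat" where
  "clique_number D =
     Min {graph_clique_number (pverts D) (backedges D r) | r. linear_order_on (pverts D) r}"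

definition chi_bounded :: "'a pair_pre_digraph set \<Rightarrow> bool" where
  "chi_bounded C \<longleftrightarrow>
     (\<exists>h :: nat \<Rightarrow> nat. mono h \<and> (\<forall>D \<in> C. dichromatic_number D \<le> h (clique_number D)))"

definition complete_to ::
    "'a pair_pre_digraph \<Rightarrow> 'a pair_pre_digraph \<Rightarrow> 'a pair_pre_digraph \<Rightarrow> bool" where
  "complete_to T A B \<longleftrightarrow> (\<forall>a \<in> pverts A. \<forall>b \<in> pverts B. (a, b) \<in> parcs T)"

definition big_to_big :: "'a pair_pre_digraph set \<Rightarrow> bool" where
  "big_to_big C \<longleftrightarrow>
     (\<exists>f :: nat \<Rightarrow> nat. \<forall>t. \<forall>T \<in> C. dichromatic_number T \<ge> f t \<longrightarrow>
        (\<exists>A B. subtournament A T \<and> subtournament B T \<and> pverts A \<inter> pverts B = {} \<and>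
           dichromatic_number A \<ge> t \<and> dichromatic_number B \<ge> t \<and> complete_to T A B))"

end

theory Submission
  imports Defs
begin

text \<open>
  Fix \<open>t\<close> and a tournament of the class with vertex set \<open>V\<close>, and suppose that it contains no pair
  \<open>A \<Rightarrow> B\<close> with both dichromatic numbers at least \<open>t\<close>. Such a tournament cannot contain a set \<open>S\<close>
  of bounded size with dichromatic number at least \<open>2t\<close>, unless its own dichromatic number is
  bounded: for each vertex outside \<open>S\<close>, its in-neighbours or its out-neighbours in \<open>S\<close> have
  dichromatic number at least \<open>t\<close>, so each of the boundedly many classes of vertices with the same
  neighbours in \<open>S\<close> has dichromatic number less than \<open>t\<close> (\<open>finite_obstruction_bounds_chi\<close>). It
  therefore suffices to find such a set \<open>S\<close> whenever the dichromatic number is large.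

  Suppose there is none. Then all subsets have dominating and absorbing sets of bounded size
  (\<open>large_domination_imp_finite_obstruction\<close>). For vertices \<open>x\<close> and \<open>y\<close> let \<open>d(x,y)\<close> be the dichromatic
  number of the set of vertices \<open>w\<close> with \<open>x \<rightarrow> w \<rightarrow> y\<close>. This satisfies the triangle inequality up to one,
  and small dominating sets bound the dichromatic number of every ball of given radius
  (\<open>chi_near_le\<close>).

  A set of bounded size and dichromatic number at least \<open>r\<close> is now found in every large subset by induction
  on \<open>r\<close>. Let \<open>c\<close> be the bound above which a set contains such an obstruction for \<open>r\<close>. If there are
  \<open>r + 1\<close> vertices such that \<open>d(x,y) \<ge> c\<close> for each arc \<open>y \<rightarrow> x\<close> between them, they and obstructions for
  \<open>r\<close> inside the intervals form an obstruction for \<open>r + 1\<close> (\<open>heavy_clique_imp_finite_obstruction\<close>).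

  Otherwise it suffices to find an ordering in which vertices \<open>x \<prec> y\<close> satisfy \<open>d(x,y) \<ge> c\<close> unless they
  lie in the same or in adjacent blocks of bounded dichromatic number; inside the blocks, a colouring
  gives the order. Then cliques of backedges have bounded size, and \<open>\<chi>\<close>-boundedness bounds the
  dichromatic number. The function \<open>d\<close> behaves as in a partial order of bounded width: a maximum set
  of vertices pairwise far apart in both directions plays the role of a maximum antichain and cuts the
  tournament into a left and a right part. A longest chain of such cuts divides the vertices into
  levels. Vertices more than one level apart are at large distance in the forward direction, and each
  level has bounded dichromatic number, by induction on the width: otherwise another cut could be
  inserted (\<open>chi_le_if_linked_sets_bounded_step\<close>). Ordering the vertices by levels is what is needed
  (\<open>order_with_small_backcliques\<close>).
\<close>

section \<open>Colourings of tournaments\<close>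

text \<open>
  In a tournament a set of vertices induces an acyclic subdigraph exactly when it contains no
  directed triangle, so the dichromatic number asks for colour classes without directed
  triangles. This form refers only to a relation and a set, and it is visibly inherited by
  subsets and invariant under reversing all arcs.
\<close>
definition coloring :: "'a rel \<Rightarrow> nat \<Rightarrow> 'a set \<Rightarrow> ('a \<Rightarrow> nat) \<Rightarrow> bool" where
  "coloring E k X f \<longleftrightarrow> f ` X \<subseteq> {..<k} \<and>
     (\<forall>x\<in>X. \<forall>y\<in>X. \<forall>z\<in>X. (x, y) \<in> E \<longrightarrow> (y, z) \<in> E \<longrightarrow> (z, x) \<in> E \<longrightarrow> f x = f y \<longrightarrow> f y \<noteq> f z)"

definition colorable :: "'a rel \<Rightarrow> nat \<Rightarrow> 'a set \<Rightarrow> bool" where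
  "colorable E k X \<longleftrightarrow> (\<exists>f. coloring E k X f)"

definition chi :: "'a rel \<Rightarrow> 'a set \<Rightarrow> nat" where
  "chi E X = (LEAST k. colorable E k X)"

definition tournament_on :: "'a rel \<Rightarrow> 'a set \<Rightarrow> bool" where
  "tournament_on E V \<longleftrightarrow> finite V \<and> (\<forall>x\<in>V. (x, x) \<notin> E) \<and>
     (\<forall>x\<in>V. \<forall>y\<in>V. (x, y) \<in> E \<longrightarrow> (y, x) \<notin> E) \<and>
     (\<forall>x\<in>V. \<forall>y\<in>V. x \<noteq> y \<longrightarrow> (x, y) \<in> E \<or> (y, x) \<in> E)"

lemma tournament_onD:
  assumes "tournament_on E V"
  shows "finite V" "x \<in> V \<Longrightarrow> (x, x) \<notin> E"
    "\<lbrakk>x \<in> V; y \<in> V; (x, y) \<in> E\<rbrakk> \<Longrightarrow> (y, x) \<notin> E"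
    "\<lbrakk>x \<in> V; y \<in> V; x \<noteq> y\<rbrakk> \<Longrightarrow> (x, y) \<in> E \<or> (y, x) \<in> E"
  using assms by (auto simp: tournament_on_def)

lemma tournament_on_subset: "\<lbrakk>tournament_on E V; X \<subseteq> V\<rbrakk> \<Longrightarrow> tournament_on E X"
  by (auto simp: tournament_on_def subset_iff intro: finite_subset)

lemma tournament_on_converse: "tournament_on (E\<inverse>) V \<longleftrightarrow> tournament_on E V"
  by (auto simp: tournament_on_def)

lemma coloringI:
  assumes "\<And>x. x \<in> X \<Longrightarrow> f x < k"
    and "\<And>x y z. \<lbrakk>x \<in> X; y \<in> X; z \<in> X; (x, y) \<in> E; (y, z) \<in> E; (z, x) \<in> E; f x = f y; f y = f z\<rbrakk> \<Longrightarrow> False"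
  shows "coloring E k X f"
  unfolding coloring_def using assms by (intro conjI) blast+

lemma coloring_less: "\<lbrakk>coloring E k X f; x \<in> X\<rbrakk> \<Longrightarrow> f x < k"
  unfolding coloring_def by blast

lemma coloring_triangle:
  "\<lbrakk>coloring E k X f; x \<in> X; y \<in> X; z \<in> X; (x, y) \<in> E; (y, z) \<in> E; (z, x) \<in> E; f x = f y; f y = f z\<rbrakk> \<Longrightarrow> False"
  unfolding coloring_def by blast

lemma coloring_mono: "\<lbrakk>coloring E k X f; k \<le> l; Y \<subseteq> X\<rbrakk> \<Longrightarrow> coloring E l Y f"
  by (rule coloringI, meson coloring_less less_le_trans subsetD, meson coloring_triangle subsetD)

lemma colorable_mono: "\<lbrakk>colorable E k X; k \<le> l; Y \<subseteq> X\<rbrakk> \<Longrightarrow> colorable E l Y"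
  unfolding colorable_def using coloring_mono by metis

lemma colorable_card:
  assumes "tournament_on E X"
  shows "colorable E (card X) X"
proof -
  obtain f where f: "bij_betw f X {0..<card X}"
    using ex_bij_betw_finite_nat tournament_onD(1)[OF assms] by blast
  have "coloring E (card X) X f"
  proof (rule coloringI)
    show "f x < card X" if "x \<in> X" for x
      using f that by (force simp: bij_betw_def)
    fix x y z assume "x \<in> X" "y \<in> X" "(x, y) \<in> E" "f x = f y"
    then show False
      using f tournament_onD(2)[OF assms] by (auto simp: bij_betw_def dest: inj_onD)
  qed
  then show ?thesis unfolding colorable_def by blast
qed

lemma colorable_Un:
  assumes "colorable E k X" "colorable E l Y"
  shows "colorable E (k + l) (X \<union> Y)"
proof -
  obtain f g where f: "coloring E k X f" and g: "coloring E l Y g"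
    using assms unfolding colorable_def by blast
  let ?h = "\<lambda>x. if x \<in> X then f x else k + g x"
  have "coloring E (k + l) (X \<union> Y) ?h"
  proof (rule coloringI)
    show "?h x < k + l" if "x \<in> X \<union> Y" for x
      using that coloring_less[OF f, of x] coloring_less[OF g, of x] by auto
    have side: "?h u = ?h v \<Longrightarrow> u \<in> X \<longleftrightarrow> v \<in> X" for u v
      using coloring_less[OF f, of u] coloring_less[OF f, of v] by (auto split: if_splits)
    fix x y z
    assume *: "x \<in> X \<union> Y" "y \<in> X \<union> Y" "z \<in> X \<union> Y" "(x, y) \<in> E" "(y, z) \<in> E" "(z, x) \<in> E"
      "?h x = ?h y" "?h y = ?h z"
    show False
    proof (cases "x \<in> X")
      case True
      then show False
        using * side[of x y] side[of y z] coloring_triangle[OF f, of x y z] by simp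
    next
      case False
      then show False
        using * side[of x y] side[of y z] coloring_triangle[OF g, of x y z] by simp
    qed
  qed
  then show ?thesis unfolding colorable_def by blast
qed

lemma chi_le: "colorable E k X \<Longrightarrow> chi E X \<le> k"
  unfolding chi_def by (rule Least_le)

lemma colorable_chi: "tournament_on E X \<Longrightarrow> colorable E (chi E X) X"
  unfolding chi_def by (rule LeastI) (rule colorable_card)

lemma less_chi:
  assumes "tournament_on E X" "\<not> colorable E k X"
  shows "k < chi E X"
proof (rule ccontr)
  assume "\<not> ?thesis"
  then have "colorable E k X" using colorable_mono[OF colorable_chi[OF assms(1)], of k X] by simp
  with assms(2) show False ..
qed

lemma chi_mono: "\<lbrakk>tournament_on E Y; X \<subseteq> Y\<rbrakk> \<Longrightarrow> chi E X \<le> chi E Y"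
  by (rule chi_le) (rule colorable_mono[OF colorable_chi order_refl])

lemma chi_le_card: "tournament_on E X \<Longrightarrow> chi E X \<le> card X"
  by (rule chi_le) (rule colorable_card)

lemma chi_empty [simp]: "chi E {} = 0"
  using chi_le_card[of E "{}"] by (simp add: tournament_on_def)

lemma chi_Un: "\<lbrakk>tournament_on E V; X \<subseteq> V; Y \<subseteq> V\<rbrakk> \<Longrightarrow> chi E (X \<union> Y) \<le> chi E X + chi E Y"
  by (intro chi_le colorable_Un colorable_chi) (blast intro: tournament_on_subset)+

lemma chi_UN:
  assumes "tournament_on E V" "finite I" "\<And>i. i \<in> I \<Longrightarrow> A i \<subseteq> V" "\<And>i. i \<in> I \<Longrightarrow> chi E (A i) \<le> b"
  shows "chi E (\<Union>i\<in>I. A i) \<le> card I * b"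
  using assms(2-4)
proof (induction I rule: finite_induct)
  case empty
  then show ?case by simp
next
  case (insert i I)
  have "chi E (A i \<union> (\<Union>i\<in>I. A i)) \<le> chi E (A i) + chi E (\<Union>i\<in>I. A i)"
    using insert.prems by (intro chi_Un[OF assms(1)]) auto
  also have "\<dots> \<le> b + card I * b"
    using insert by (intro add_mono) auto
  finally show ?case using insert by simp
qed

lemma colorable_converse: "colorable (E\<inverse>) k X \<longleftrightarrow> colorable E k X"
proof -
  have "coloring (E\<inverse>) k X f" if "coloring E k X f" for E :: "'a rel" and f
  proof (rule coloringI)
    show "f x < k" if "x \<in> X" for x using coloring_less \<open>coloring E k X f\<close> that by metis
    fix x y z
    assume "x \<in> X" "y \<in> X" "z \<in> X" "(x, y) \<in> E\<inverse>" "(y, z) \<in> E\<inverse>" "(z, x) \<in> E\<inverse>" "f x = f y" "f y = f z"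
    then show False using coloring_triangle[OF that, of z y x] by simp
  qed
  from this[of E] this[of "E\<inverse>"] show ?thesis unfolding colorable_def by auto
qed

lemma chi_converse: "chi (E\<inverse>) X = chi E X"
  by (simp add: chi_def colorable_converse)

text \<open>
  If a colour were missing on \<open>X\<close>, the last colour could be renamed to it, which would save one.
  Every triangle argument below uses this to find a vertex of a prescribed colour.
\<close>
lemma coloring_uses_all_colors:
  assumes f: "coloring E k V f" and X: "X \<subseteq> V" "k \<le> chi E X" and i: "i < k"
  shows "\<exists>x\<in>X. f x = i"
proof (rule ccontr)
  assume "\<not> ?thesis"
  then have ni: "f x \<noteq> i" if "x \<in> X" for x using that by blast
  have fX: "coloring E k X f" using coloring_mono[OF f] X by simp
  let ?g = "\<lambda>x. if f x = k - 1 then i else f x"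
  have "coloring E (k - 1) X ?g"
  proof (rule coloringI)
    show "?g x < k - 1" if "x \<in> X" for x
      using coloring_less[OF fX that] ni[OF that] i by (cases "i = k - 1") auto
    fix x y z
    assume *: "x \<in> X" "y \<in> X" "z \<in> X" "(x, y) \<in> E" "(y, z) \<in> E" "(z, x) \<in> E" "?g x = ?g y" "?g y = ?g z"
    then have "f x = f y" "f y = f z"
      using ni[of x] ni[of y] ni[of z] by (auto split: if_splits)
    then show False using coloring_triangle[OF fX, of x y z] * by blast
  qed
  then show False using chi_le[of E "k - 1" X] X i unfolding colorable_def by force
qed

section \<open>Domination and bounded obstructions\<close>
definition dominates :: "'a rel \<Rightarrow> 'a set \<Rightarrow> 'a set \<Rightarrow> bool" where
  "dominates E D X \<longleftrightarrow> D \<subseteq> X \<and> (\<forall>x\<in>X. x \<in> D \<or> (\<exists>d\<in>D. (d, x) \<in> E))"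

text \<open>
  If no small set dominates \<open>V\<close>, then a subset of bounded size already needs \<open>k\<close> colours
  (a lemma of Harutyunyan, Le, Thomasse and Wu). In the induction step \<open>D\<close> is a minimum dominating
  set and \<open>B\<close> a large part of it. A \<open>k\<close>-chromatic set \<open>A\<close> of bounded size lies among the vertices
  not dominated by \<open>B\<close>, so \<open>A \<Rightarrow> B\<close>. For \<open>B' \<subseteq> B\<close> the set \<open>(D - B') \<union> A\<close> is much smaller than \<open>D\<close>,
  so the vertices it leaves undominated again contain a bounded \<open>k\<close>-chromatic set \<open>AA B'\<close>;
  its vertices point to \<open>A\<close> and each has an in-neighbour in \<open>B'\<close>. A \<open>k\<close>-colouring of \<open>B\<close>, \<open>A\<close> and
  all \<open>AA B'\<close> has a large monochromatic \<open>B' \<subseteq> B\<close>, and then \<open>B'\<close>, \<open>AA B'\<close> and \<open>A\<close> contain a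
  triangle of that colour.
\<close>
lemma large_domination_imp_finite_obstruction:
  "\<exists>K l. \<forall>E (V :: 'a set). tournament_on E V \<longrightarrow> (\<forall>D. dominates E D V \<longrightarrow> K \<le> card D) \<longrightarrow>
     (\<exists>S\<subseteq>V. card S \<le> l \<and> k \<le> chi E S)"
proof (induction k)
  case 0
  show ?case by (rule exI[of _ 0], rule exI[of _ 0]) auto
next
  case (Suc k)
  then obtain K l where IH: "\<And>E (V :: 'a set). \<lbrakk>tournament_on E V; \<And>D. dominates E D V \<Longrightarrow> K \<le> card D\<rbrakk> \<Longrightarrow>
     \<exists>S\<subseteq>V. card S \<le> l \<and> k \<le> chi E S"
    by blast
  define s where "s = l + K"
  define m where "m = Suc (k * s)"
  have "\<exists>S\<subseteq>V. card S \<le> m + l + 2 ^ m * l \<and> Suc k \<le> chi E S"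
    if V: "tournament_on E V" and dom: "\<And>D. dominates E D V \<Longrightarrow> m + K \<le> card D"
    for E and V :: "'a set"
  proof -
    note fin = tournament_onD(1)[OF V]
    have "dominates E V V" by (auto simp: dominates_def)
    then obtain D where D: "dominates E D V" and Dmin: "\<And>D'. dominates E D' V \<Longrightarrow> card D \<le> card D'"
      using exists_least_iff[of "\<lambda>n. \<exists>D. dominates E D V \<and> card D = n"]
      by (metis not_less)
    have DV: "D \<subseteq> V" using D by (simp add: dominates_def)
    then have finD: "finite D" using fin finite_subset by blast
    have "m \<le> card D" using dom[OF D] by simp
    then obtain B where B: "B \<subseteq> D" "card B = m" by (meson obtain_subset_with_card_n)
    have finB: "finite B" using B finD finite_subset by blast
    \<comment> \<open>the closed out-neighbourhood of a set\<close>
    let ?N = "\<lambda>X. {x\<in>V. x \<in> X \<or> (\<exists>d\<in>X. (d, x) \<in> E)}"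
    have extend: "dominates E (X \<union> Y) V" if "X \<subseteq> V" "dominates E Y (V - ?N X)" for X Y
      using that unfolding dominates_def by blast
    have sub: "\<exists>S\<subseteq>V - ?N X. card S \<le> l \<and> k \<le> chi E S"
      if "X \<subseteq> V" "card X + K \<le> card D" for X
    proof (rule IH)
      show "tournament_on E (V - ?N X)" using V tournament_on_subset by blast
      fix D' assume "dominates E D' (V - ?N X)"
      then have "card D \<le> card (X \<union> D')" using Dmin extend that by blast
      also have "\<dots> \<le> card X + card D'" by (rule card_Un_le)
      finally show "K \<le> card D'" using that by simp
    qed
    have "card B + K \<le> card D" using dom[OF D] B by simp
    then obtain A where A: "A \<subseteq> V - ?N B" "card A \<le> l" "k \<le> chi E A"
      using sub[of B] B DV by blast
    have AB: "(a, b) \<in> E" if "a \<in> A" "b \<in> B" for a b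
      using that A B DV tournament_onD(4)[OF V, of a b] by blast
    define BB where "BB = {B'. B' \<subseteq> B \<and> s \<le> card B'}"
    have finBB: "finite BB" using finB by (simp add: BB_def)
    have "\<forall>B'\<in>BB. \<exists>S\<subseteq>V - ?N ((D - B') \<union> A). card S \<le> l \<and> k \<le> chi E S"
    proof (intro ballI sub)
      fix B' assume "B' \<in> BB"
      then have that: "B' \<subseteq> B" "s \<le> card B'" by (auto simp: BB_def)
      show "(D - B') \<union> A \<subseteq> V" using A DV by blast
      have "card ((D - B') \<union> A) \<le> card (D - B') + card A" by (rule card_Un_le)
      also have "card (D - B') = card D - card B'"
        using that B finD by (meson card_Diff_subset finite_subset order_trans)
      finally have "card ((D - B') \<union> A) \<le> card D - card B' + card A" .
      moreover have "card B' \<le> card D" using that(1) B(1) by (intro card_mono[OF finD]) blast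
      ultimately show "card ((D - B') \<union> A) + K \<le> card D"
        using A(2) that(2) unfolding s_def by linarith
    qed
    from bchoice[OF this[unfolded Bex_def]] obtain AA where AA: "\<And>B'. B' \<in> BB \<Longrightarrow>
        AA B' \<subseteq> V - ?N ((D - B') \<union> A) \<and> card (AA B') \<le> l \<and> k \<le> chi E (AA B')"
      by auto
    define S where "S = B \<union> A \<union> (\<Union>B'\<in>BB. AA B')"
    have SV: "S \<subseteq> V" using A(1) B DV AA unfolding S_def by blast
    have TS: "tournament_on E S" by (rule tournament_on_subset[OF V SV])
    have "card S \<le> card (B \<union> A) + card (\<Union>B'\<in>BB. AA B')"
      unfolding S_def by (rule card_Un_le)
    also have "card (B \<union> A) \<le> m + l" using card_Un_le[of B A] A(2) B(2) by simp
    also have "card (\<Union>B'\<in>BB. AA B') \<le> (\<Sum>B'\<in>BB. card (AA B'))" by (rule card_UN_le[OF finBB])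
    also have "\<dots> \<le> card BB * l"
      using sum_bounded_above[of BB "\<lambda>B'. card (AA B')" l] AA by simp
    also have "\<dots> \<le> 2 ^ m * l"
      using card_mono[of "Pow B" BB] finB B(2) by (auto simp: BB_def card_Pow)
    finally have card_S: "card S \<le> m + l + 2 ^ m * l" by simp
    have "\<not> colorable E k S"
    proof
      assume "colorable E k S"
      then obtain f where f: "coloring E k S f" unfolding colorable_def by blast
      have "\<exists>i<k. s < card {b\<in>B. f b = i}"
      proof (rule ccontr)
        assume "\<not> ?thesis"
        then have small: "card {b\<in>B. f b = i} \<le> s" if "i < k" for i using that by (meson not_less)
        have eq: "B = (\<Union>i<k. {b\<in>B. f b = i})" using coloring_less[OF f] by (auto simp: S_def)
        have "card B = card (\<Union>i<k. {b\<in>B. f b = i})" by (rule arg_cong[OF eq])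
        also have "\<dots> \<le> (\<Sum>i<k. card {b\<in>B. f b = i})" by (rule card_UN_le) simp
        also have "\<dots> \<le> k * s"
          using sum_bounded_above[of "{..<k}" "\<lambda>i. card {b\<in>B. f b = i}" s] small by simp
        finally show False using B(2) by (simp add: m_def)
      qed
      then obtain i where i: "i < k" "s < card {b\<in>B. f b = i}" by blast
      define B' where "B' = {b\<in>B. f b = i}"
      have B': "B' \<in> BB" "B' \<subseteq> B" using i by (auto simp: BB_def B'_def)
      have AA': "AA B' \<subseteq> V - ?N ((D - B') \<union> A)" "k \<le> chi E (AA B')"
        using AA[OF B'(1)] by blast+
      have AAS: "AA B' \<subseteq> S" "A \<subseteq> S" "B \<subseteq> S" using B' by (auto simp: S_def)
      obtain x where x: "x \<in> AA B'" "f x = i"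
        using coloring_uses_all_colors[OF f AAS(1) AA'(2) i(1)] by blast
      obtain a where a: "a \<in> A" "f a = i"
        using coloring_uses_all_colors[OF f AAS(2) A(3) i(1)] by blast
      \<comment> \<open>the triangle will be \<open>b \<rightarrow> x \<rightarrow> a \<rightarrow> b\<close>, all of colour \<open>i\<close>\<close>
      have xa: "(x, a) \<in> E"
        using x a AA' A tournament_onD(4)[OF V, of x a] by blast
      have "x \<notin> B'"
        using AB[of a x] xa a B' tournament_onD(3)[OF V, of a x] A B DV by blast
      then have "x \<notin> D" using x AA' by blast
      then obtain b where b: "b \<in> D" "(b, x) \<in> E"
        using D x AA' by (auto simp: dominates_def)
      then have bB: "b \<in> B'" using x AA' by blast
      show False
        using coloring_triangle[OF f, of b x a] AB[of a b] bB b xa x a B' AAS by (auto simp: B'_def subset_iff)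
    qed
    then have "Suc k \<le> chi E S" by (rule Suc_leI[OF less_chi[OF TS]])
    then show ?thesis by (intro exI[of _ S] conjI SV card_S)
  qed
  then show ?case by (intro exI[of _ "m + K"] exI[of _ "m + l + 2 ^ m * l"] allI impI) simp
qed

text \<open>
  Split \<open>V\<close> outside \<open>S\<close> into the at most \<open>2 ^ n\<close> classes \<open>Z X\<close> of vertices with the same in-neighbours
  \<open>X\<close> in \<open>S\<close>. Then \<open>X \<Rightarrow> Z X \<Rightarrow> S - X\<close>, and one of \<open>X\<close> and \<open>S - X\<close> has dichromatic number at least
  \<open>t\<close>, so the class \<open>Z X\<close> has not, for lack of a complete pair.
\<close>
lemma finite_obstruction_bounds_chi:
  assumes V: "tournament_on E V"
    and free: "\<And>A B. \<lbrakk>A \<subseteq> V; B \<subseteq> V; \<And>a b. \<lbrakk>a \<in> A; b \<in> B\<rbrakk> \<Longrightarrow> (a, b) \<in> E\<rbrakk> \<Longrightarrow> chi E A < t \<or> chi E B < t"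
    and S: "S \<subseteq> V" "card S \<le> n" "2 * t \<le> chi E S"
  shows "chi E V \<le> n + 2 ^ n * t"
proof -
  define Z where "Z = (\<lambda>X. {v \<in> V - S. {s\<in>S. (s, v) \<in> E} = X})"
  have finS: "finite S" using S V tournament_onD(1) finite_subset by blast
  have Z: "chi E (Z X) \<le> t" if "X \<in> Pow S" for X
  proof -
    have X: "X \<subseteq> S" using that by simp
    have "chi E S \<le> chi E X + chi E (S - X)"
      using chi_Un[OF V, of X "S - X"] X S by (simp add: Un_absorb1 subset_trans subset_iff)
    then have "t \<le> chi E X \<or> t \<le> chi E (S - X)" using S by linarith
    moreover have "chi E X < t \<or> chi E (Z X) < t"
      using X S by (intro free) (auto simp: Z_def)
    moreover have "chi E (Z X) < t \<or> chi E (S - X) < t"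
    proof (rule free)
      show "Z X \<subseteq> V" "S - X \<subseteq> V" using S by (auto simp: Z_def)
      fix a b assume "a \<in> Z X" "b \<in> S - X"
      then show "(a, b) \<in> E" using tournament_onD(4)[OF V, of a b] S by (auto simp: Z_def)
    qed
    ultimately show ?thesis by linarith
  qed
  have "V = S \<union> (\<Union>X\<in>Pow S. Z X)" using S by (auto simp: Z_def)
  then have "chi E V \<le> chi E S + chi E (\<Union>X\<in>Pow S. Z X)"
    using chi_Un[OF V S(1), of "\<Union>X\<in>Pow S. Z X"] by (metis Un_upper2)
  also have "chi E S \<le> n"
    using chi_le_card[OF tournament_on_subset[OF V S(1)]] S by linarith
  also have "chi E (\<Union>X\<in>Pow S. Z X) \<le> card (Pow S) * t"
    using Z finS by (intro chi_UN[OF V]) (auto simp: Z_def)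
  also have "card (Pow S) * t \<le> 2 ^ n * t"
    using S finS by (simp add: card_Pow)
  finally show ?thesis by simp
qed

section \<open>The interval distance\<close>

text \<open>
  The set measured here is the interval of vertices that come after \<open>x\<close> and before \<open>y\<close>.
  If \<open>y \<rightarrow> x\<close> is an arc, it is the set of vertices that complete this arc to a directed triangle.
\<close>
definition gap :: "'a rel \<Rightarrow> 'a set \<Rightarrow> 'a \<Rightarrow> 'a \<Rightarrow> nat" where
  "gap E V x y = chi E {w\<in>V. (x, w) \<in> E \<and> (w, y) \<in> E}"

lemma gap_refl: "\<lbrakk>tournament_on E V; x \<in> V\<rbrakk> \<Longrightarrow> gap E V x x = 0"
proof -
  assume "tournament_on E V" "x \<in> V"
  then have "{w\<in>V. (x, w) \<in> E \<and> (w, x) \<in> E} = {}" using tournament_onD(3) by fast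
  then show ?thesis unfolding gap_def by (simp only: chi_empty)
qed

text \<open>
  A vertex \<open>w \<noteq> y\<close> between \<open>x\<close> and \<open>z\<close> either points to \<open>y\<close>, and lies between \<open>x\<close> and \<open>y\<close>, or is
  pointed to by \<open>y\<close>, and lies between \<open>y\<close> and \<open>z\<close>.
\<close>
lemma gap_triangle:
  assumes V: "tournament_on E V" and "x \<in> V" "y \<in> V" "z \<in> V"
  shows "gap E V x z \<le> gap E V x y + gap E V y z + 1"
proof -
  let ?I = "\<lambda>x y. {w\<in>V. (x, w) \<in> E \<and> (w, y) \<in> E}"
  have "?I x z \<subseteq> (?I x y \<union> ?I y z) \<union> {y}"
    using tournament_onD(4)[OF V] assms by blast
  then have "chi E (?I x z) \<le> chi E ((?I x y \<union> ?I y z) \<union> {y})"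
    using assms by (intro chi_mono[OF tournament_on_subset[OF V]]) auto
  also have "\<dots> \<le> chi E (?I x y \<union> ?I y z) + chi E {y}"
    using assms by (intro chi_Un[OF V]) auto
  also have "chi E (?I x y \<union> ?I y z) \<le> chi E (?I x y) + chi E (?I y z)"
    by (intro chi_Un[OF V]) auto
  also have "chi E {y} \<le> 1"
    using chi_le_card[OF tournament_on_subset[OF V, of "{y}"]] assms by simp
  finally show ?thesis by (simp add: gap_def)
qed

text \<open>
  The converse relation is included because the proof is symmetric under reversing all arcs:
  both dominating and absorbing sets are used.
\<close>
definition small_dominating :: "nat \<Rightarrow> 'a rel \<Rightarrow> 'a set \<Rightarrow> bool" where
  "small_dominating \<kappa> E V \<longleftrightarrow> (\<forall>Y\<subseteq>V. (\<exists>D. dominates E D Y \<and> card D \<le> \<kappa>) \<and>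
     (\<exists>D. dominates (E\<inverse>) D Y \<and> card D \<le> \<kappa>))"

lemma chi_le_if_small_out_neighbourhoods:
  assumes Y: "tournament_on E Y" and D: "dominates E D Y" "card D \<le> \<kappa>"
    and out: "\<And>y. y \<in> Y \<Longrightarrow> chi E {w\<in>Y. (y, w) \<in> E} \<le> g"
  shows "chi E Y \<le> \<kappa> * (g + 1)"
proof -
  have DY: "D \<subseteq> Y" using D by (simp add: dominates_def)
  have finD: "finite D" using DY Y tournament_onD(1) finite_subset by blast
  have "Y = (\<Union>d\<in>D. {w\<in>Y. (d, w) \<in> E} \<union> {d})"
    using D by (auto simp: dominates_def)
  moreover have "chi E (\<Union>d\<in>D. {w\<in>Y. (d, w) \<in> E} \<union> {d}) \<le> card D * (g + 1)"
  proof (rule chi_UN[OF Y finD])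
    fix d assume d: "d \<in> D"
    then show sub: "{w\<in>Y. (d, w) \<in> E} \<union> {d} \<subseteq> Y" using DY by blast
    have "chi E ({w\<in>Y. (d, w) \<in> E} \<union> {d}) \<le> chi E {w\<in>Y. (d, w) \<in> E} + chi E {d}"
      using sub by (intro chi_Un[OF Y]) auto
    moreover have "chi E {d} \<le> 1"
      using chi_le_card[OF tournament_on_subset[OF Y, of "{d}"]] d DY by auto
    ultimately show "chi E ({w\<in>Y. (d, w) \<in> E} \<union> {d}) \<le> g + 1"
      using out[of d] d DY by fastforce
  qed
  ultimately have "chi E Y \<le> card D * (g + 1)" by simp
  also have "\<dots> \<le> \<kappa> * (g + 1)" using D(2) by (rule mult_le_mono1)
  finally show ?thesis .
qed

definition near :: "'a rel \<Rightarrow> 'a set \<Rightarrow> nat \<Rightarrow> 'a \<Rightarrow> 'a set" where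
  "near E V g x = {y\<in>V. gap E V x y \<le> g \<and> gap E V y x \<le> g}"

text \<open>
  Among the out-neighbours \<open>P\<close> of \<open>x\<close> in the ball, a vertex \<open>v\<close> has all its in-neighbours in the
  interval from \<open>x\<close> to \<open>v\<close>, so every in-neighbourhood inside \<open>P\<close> is small, and a small absorbing
  set of \<open>P\<close> gives a bound for \<open>P\<close>. The in-neighbours of \<open>x\<close> are treated dually.
\<close>
lemma chi_near_le:
  assumes V: "tournament_on E V" and dom: "small_dominating \<kappa> E V" and x: "x \<in> V"
  shows "chi E (near E V g x) \<le> 1 + 2 * (\<kappa> * (g + 1))"
proof -
  define P where "P = {y\<in>near E V g x. (x, y) \<in> E}"
  define Q where "Q = {y\<in>near E V g x. (y, x) \<in> E}"
  have PQ: "P \<subseteq> V" "Q \<subseteq> V" by (auto simp: P_def Q_def near_def)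
  have Vc: "tournament_on (E\<inverse>) V" using V by (simp add: tournament_on_converse)
  have "chi E P \<le> \<kappa> * (g + 1)"
  proof -
    obtain D where "dominates (E\<inverse>) D P" "card D \<le> \<kappa>"
      using dom PQ unfolding small_dominating_def by blast
    moreover have "chi (E\<inverse>) {w\<in>P. (v, w) \<in> E\<inverse>} \<le> g" if "v \<in> P" for v
    proof -
      have "chi E {w\<in>P. (w, v) \<in> E} \<le> gap E V x v"
        unfolding gap_def by (rule chi_mono[OF tournament_on_subset[OF V]]) (use PQ in \<open>auto simp: P_def\<close>)
      then show ?thesis using that by (simp add: chi_converse P_def near_def)
    qed
    ultimately have "chi (E\<inverse>) P \<le> \<kappa> * (g + 1)"
      by (intro chi_le_if_small_out_neighbourhoods[OF tournament_on_subset[OF Vc PQ(1)]])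
    then show ?thesis by (simp add: chi_converse)
  qed
  moreover have "chi E Q \<le> \<kappa> * (g + 1)"
  proof -
    obtain D where "dominates E D Q" "card D \<le> \<kappa>"
      using dom PQ unfolding small_dominating_def by blast
    moreover have "chi E {w\<in>Q. (v, w) \<in> E} \<le> g" if "v \<in> Q" for v
    proof -
      have "chi E {w\<in>Q. (v, w) \<in> E} \<le> gap E V v x"
        unfolding gap_def by (rule chi_mono[OF tournament_on_subset[OF V]]) (use PQ in \<open>auto simp: Q_def\<close>)
      then show ?thesis using that by (simp add: Q_def near_def)
    qed
    ultimately show ?thesis
      by (intro chi_le_if_small_out_neighbourhoods[OF tournament_on_subset[OF V PQ(2)]])
  qed
  moreover have "chi E {x} \<le> 1"
    using chi_le_card[OF tournament_on_subset[OF V, of "{x}"]] x by simp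
  moreover have "chi E (near E V g x) \<le> chi E ({x} \<union> (P \<union> Q))"
    using PQ x tournament_onD(4)[OF V]
    by (intro chi_mono[OF tournament_on_subset[OF V]]) (auto simp: P_def Q_def near_def)
  moreover have "chi E ({x} \<union> (P \<union> Q)) \<le> chi E {x} + chi E (P \<union> Q)"
    using PQ x by (intro chi_Un[OF V]) auto
  moreover have "chi E (P \<union> Q) \<le> chi E P + chi E Q"
    using PQ by (intro chi_Un[OF V]) auto
  ultimately show ?thesis by linarith
qed

section \<open>Orderings from levels\<close>
definition backclique :: "'a rel \<Rightarrow> 'a rel \<Rightarrow> 'a set \<Rightarrow> bool" where
  "backclique E r K \<longleftrightarrow> (\<forall>x\<in>K. \<forall>y\<in>K. (x, y) \<in> r \<longrightarrow> x \<noteq> y \<longrightarrow> (y, x) \<in> E)"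

text \<open>
  Every arc \<open>y \<rightarrow> x\<close> inside such a set is completed to a directed triangle by a set of dichromatic
  number at least \<open>c\<close>.
\<close>
definition heavy :: "'a rel \<Rightarrow> 'a set \<Rightarrow> nat \<Rightarrow> 'a set \<Rightarrow> bool" where
  "heavy E V c K \<longleftrightarrow> (\<forall>x\<in>K. \<forall>y\<in>K. (y, x) \<in> E \<longrightarrow> c \<le> gap E V x y)"

text \<open>
  Order \<open>U\<close> by level, inside a level by the colours of a \<open>q\<close>-colouring, and inside a colour class,
  which is transitive, by \<open>E\<close>. No backedge stays inside a colour class. In a clique of backedges the
  vertices of one colour whose levels have the same parity therefore have levels at distance at
  least two, so they form a heavy set, which has at most \<open>r\<close> vertices.
\<close>
lemma order_with_small_backcliques:
  fixes lev :: "'a \<Rightarrow> nat"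
  assumes U: "tournament_on E U"
    and col: "\<And>n. chi E {a\<in>U. lev a = n} \<le> q"
    and far: "\<And>a b. \<lbrakk>a \<in> U; b \<in> U; lev a + 2 \<le> lev b\<rbrakk> \<Longrightarrow> c \<le> gap E V a b"
    and heavy: "\<And>K. \<lbrakk>K \<subseteq> U; heavy E V c K\<rbrakk> \<Longrightarrow> card K \<le> r"
  shows "\<exists>R. linear_order_on U R \<and> (\<forall>K\<subseteq>U. backclique E R K \<longrightarrow> card K \<le> 2 * q * r)"
proof -
  have "\<exists>f. coloring E q {a\<in>U. lev a = n} f" for n
    using colorable_mono[OF colorable_chi col[of n] order_refl] tournament_on_subset[OF U, of "{a\<in>U. lev a = n}"]
    unfolding colorable_def by blast
  then obtain F where F: "\<And>n. coloring E q {a\<in>U. lev a = n} (F n)" by metis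
  define f where "f = (\<lambda>x. F (lev x) x)"
  have f: "f x < q" if "x \<in> U" for x using coloring_less[OF F, of x] that by (simp add: f_def)
  have f3: False if "x \<in> U" "y \<in> U" "z \<in> U" "lev x = lev y" "lev y = lev z" "f x = f y" "f y = f z"
    "(x, y) \<in> E" "(y, z) \<in> E" "(z, x) \<in> E" for x y z
    using coloring_triangle[OF F[of "lev z"], of x y z] that by (simp add: f_def)
  define R where "R = {(a, b). a \<in> U \<and> b \<in> U \<and> (lev a < lev b \<or> lev a = lev b \<and>
     (f a < f b \<or> f a = f b \<and> (a = b \<or> (a, b) \<in> E)))}"
  have tr: "(x, z) \<in> E" if "x \<in> U" "y \<in> U" "z \<in> U" "lev x = lev y" "lev y = lev z" "f x = f y" "f y = f z"
    "(x, y) \<in> E" "(y, z) \<in> E" for x y z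
    using f3[OF that(1-9)] tournament_onD(4)[OF U, of x z] tournament_onD(3)[OF U, of x y] that by blast
  have "linear_order_on U R"
    unfolding linear_order_on_def partial_order_on_def preorder_on_def
  proof (intro conjI)
    show "R \<subseteq> U \<times> U" "refl_on U R" by (auto simp: R_def refl_on_def)
    show "antisym R"
    proof (rule antisymI)
      fix x y assume "(x, y) \<in> R" "(y, x) \<in> R"
      then show "x = y" using tournament_onD(3)[OF U, of x y] by (auto simp: R_def)
    qed
    show "total_on U R"
    proof (rule total_onI)
      fix x y assume "x \<in> U" "y \<in> U" "x \<noteq> y"
      then show "(x, y) \<in> R \<or> (y, x) \<in> R"
        using tournament_onD(4)[OF U, of x y] unfolding R_def by auto
    qed
    show "trans R"
    proof (rule transI)
      fix x y z assume "(x, y) \<in> R" "(y, z) \<in> R"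
      then show "(x, z) \<in> R" unfolding R_def using tr[of x y z] by auto
    qed
  qed
  moreover have "card K \<le> 2 * q * r" if K: "K \<subseteq> U" "backclique E R K" for K
  proof -
    have finK: "finite K" using K U tournament_onD(1) finite_subset by blast
    define L where "L = (\<lambda>(p, j). {a\<in>K. lev a mod 2 = p \<and> f a = j})"
    have sep: "lev a \<noteq> lev b" if "a \<in> K" "b \<in> K" "f a = f b" "a \<noteq> b" for a b
    proof
      assume l: "lev a = lev b"
      have ab: "a \<in> U" "b \<in> U" using that K by auto
      have "(a, b) \<in> E \<or> (b, a) \<in> E" using tournament_onD(4)[OF U ab] that by blast
      then show False
      proof
        assume e: "(a, b) \<in> E"
        then have "(a, b) \<in> R" using l that ab by (simp add: R_def)
        then have "(b, a) \<in> E" using K(2) that by (simp add: backclique_def)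
        then show False using tournament_onD(3)[OF U ab e] by simp
      next
        assume e: "(b, a) \<in> E"
        then have "(b, a) \<in> R" using l that ab by (simp add: R_def)
        then have "(a, b) \<in> E" using K(2) that by (simp add: backclique_def)
        then show False using tournament_onD(3)[OF U ab(2) ab(1) e] by simp
      qed
    qed
    have L: "card (L pj) \<le> r" for pj
    proof (rule heavy)
      obtain p j where pj: "pj = (p, j)" by force
      show "L pj \<subseteq> U" using K by (auto simp: L_def pj)
      show "heavy E V c (L pj)"
        unfolding heavy_def
      proof (intro ballI impI)
        fix x y assume xy: "x \<in> L pj" "y \<in> L pj" "(y, x) \<in> E"
        then have m: "x \<in> K" "y \<in> K" "f x = f y" "lev x mod 2 = lev y mod 2" by (auto simp: L_def pj)
        have U': "x \<in> U" "y \<in> U" using m K by auto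
        have "x \<noteq> y" using xy tournament_onD(2)[OF U U'(1)] by blast
        have "\<not> lev y < lev x"
        proof
          assume "lev y < lev x"
          then have "(y, x) \<in> R" using U' by (simp add: R_def)
          then have "(x, y) \<in> E" using K(2) m \<open>x \<noteq> y\<close> by (auto simp: backclique_def)
          then show False using tournament_onD(3)[OF U U' ] xy(3) by blast
        qed
        then have "lev x < lev y" using sep[OF m(1-3) \<open>x \<noteq> y\<close>] by simp
        then have "lev x + 2 \<le> lev y" using m(4) by presburger
        then show "c \<le> gap E V x y" using far U' by blast
      qed
    qed
    have "K \<subseteq> (\<Union>pj\<in>{..<2} \<times> {..<q}. L pj)" using f K by (fastforce simp: L_def)
    then have "card K \<le> card (\<Union>pj\<in>{..<2} \<times> {..<q}. L pj)"
      using finK by (intro card_mono finite_UN_I) (auto simp: L_def)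
    also have "\<dots> \<le> (\<Sum>pj\<in>{..<2} \<times> {..<q}. card (L pj))" by (rule card_UN_le) auto
    also have "\<dots> \<le> card ({..<2::nat} \<times> {..<q}) * r"
      using sum_bounded_above[of "{..<2} \<times> {..<q}" "\<lambda>pj. card (L pj)" r] L by simp
    finally show ?thesis by simp
  qed
  ultimately show ?thesis by blast
qed

text \<open>
  Add to \<open>K\<close>, for each arc \<open>y \<rightarrow> x\<close> in it, a bounded set \<open>M (x, y)\<close> of dichromatic number at least
  \<open>r\<close> between \<open>x\<close> and \<open>y\<close>. Under an \<open>r\<close>-colouring two of the \<open>r + 1\<close> vertices of \<open>K\<close> share a colour,
  which also occurs on the set between them and gives a monochromatic triangle.
\<close>
lemma heavy_clique_imp_finite_obstruction:
  assumes V: "tournament_on E V" and K: "K \<subseteq> V" "heavy E V c K" "card K = Suc r"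
    and obs: "\<And>X. \<lbrakk>X \<subseteq> V; c \<le> chi E X\<rbrakk> \<Longrightarrow> \<exists>S\<subseteq>X. card S \<le> n \<and> r \<le> chi E S"
  shows "\<exists>S\<subseteq>V. card S \<le> Suc r + Suc r ^ 2 * n \<and> Suc r \<le> chi E S"
proof -
  have finK: "finite K" using K V tournament_onD(1) finite_subset by blast
  have "\<forall>xy\<in>K \<times> K. \<exists>M\<subseteq>{w\<in>V. (fst xy, w) \<in> E \<and> (w, snd xy) \<in> E}.
      card M \<le> n \<and> ((snd xy, fst xy) \<in> E \<longrightarrow> r \<le> chi E M)"
  proof
    fix xy assume xy: "xy \<in> K \<times> K"
    show "\<exists>M\<subseteq>{w\<in>V. (fst xy, w) \<in> E \<and> (w, snd xy) \<in> E}.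
      card M \<le> n \<and> ((snd xy, fst xy) \<in> E \<longrightarrow> r \<le> chi E M)"
    proof (cases "(snd xy, fst xy) \<in> E")
      case True
      then have "c \<le> gap E V (fst xy) (snd xy)" using K(2) xy by (auto simp: heavy_def)
      then show ?thesis
        using obs[of "{w\<in>V. (fst xy, w) \<in> E \<and> (w, snd xy) \<in> E}"] by (auto simp: gap_def)
    next
      case False
      then show ?thesis by (intro exI[of _ "{}"]) auto
    qed
  qed
  from bchoice[OF this] obtain M where "\<forall>xy\<in>K \<times> K.
      M xy \<subseteq> {w\<in>V. (fst xy, w) \<in> E \<and> (w, snd xy) \<in> E} \<and>
      card (M xy) \<le> n \<and> ((snd xy, fst xy) \<in> E \<longrightarrow> r \<le> chi E (M xy))" ..
  then have M: "M xy \<subseteq> {w\<in>V. (fst xy, w) \<in> E \<and> (w, snd xy) \<in> E} \<and>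
      card (M xy) \<le> n \<and> ((snd xy, fst xy) \<in> E \<longrightarrow> r \<le> chi E (M xy))" if "xy \<in> K \<times> K" for xy
    using that by (rule bspec)
  define S where "S = K \<union> (\<Union>xy\<in>K\<times>K. M xy)"
  have SV: "S \<subseteq> V" using K(1) M unfolding S_def by blast
  have TS: "tournament_on E S" by (rule tournament_on_subset[OF V SV])
  have "card S \<le> card K + card (\<Union>xy\<in>K\<times>K. M xy)" unfolding S_def by (rule card_Un_le)
  also have "card (\<Union>xy\<in>K\<times>K. M xy) \<le> (\<Sum>xy\<in>K\<times>K. card (M xy))"
    using finK by (intro card_UN_le) simp
  also have "\<dots> \<le> card (K \<times> K) * n"
    using sum_bounded_above[of "K \<times> K" "\<lambda>xy. card (M xy)" n] M by simp
  also have "\<dots> = Suc r ^ 2 * n" using K by (simp add: card_cartesian_product power2_eq_square)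
  finally have card_S: "card S \<le> Suc r + Suc r ^ 2 * n" using K by simp
  have "\<not> colorable E r S"
  proof
    assume "colorable E r S"
    then obtain f where f: "coloring E r S f" unfolding colorable_def by blast
    have "f ` K \<subseteq> {..<r}" using coloring_less[OF f] by (auto simp: S_def)
    then have "card (f ` K) < card K" using K(3) card_mono[of "{..<r}" "f ` K"] by simp
    then have "\<not> inj_on f K" using pigeonhole by blast
    then obtain x y where xy: "x \<in> K" "y \<in> K" "x \<noteq> y" "f x = f y" by (auto simp: inj_on_def)
    have main: False if xy: "x \<in> K" "y \<in> K" "f x = f y" "(y, x) \<in> E" for x y
    proof -
      have MS: "M (x, y) \<subseteq> S" "x \<in> S" "y \<in> S" using xy by (auto simp: S_def)
      obtain z where z: "z \<in> M (x, y)" "f z = f x"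
        using coloring_uses_all_colors[OF f MS(1)] coloring_less[OF f MS(2)] M[of "(x, y)"] xy by simp blast
      have "(x, z) \<in> E" "(z, y) \<in> E" using M[of "(x, y)"] xy z(1) by auto
      then show False using coloring_triangle[OF f, of x z y] MS xy z by auto
    qed
    show False using main[of x y] main[of y x] xy tournament_onD(4)[OF V, of x y] K by auto
  qed
  then have "Suc r \<le> chi E S" by (rule Suc_leI[OF less_chi[OF TS]])
  then show ?thesis by (intro exI[of _ S] conjI SV card_S)
qed

section \<open>Cuts\<close>

text \<open>
  Linked vertices have a large interval between them in both directions, so neither can
  be said to come before the other. In the analogy with a partial order, linked sets are antichains.
\<close>
definition linked :: "'a rel \<Rightarrow> 'a set \<Rightarrow> nat \<Rightarrow> 'a set \<Rightarrow> bool" where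
  "linked E V c K \<longleftrightarrow> (\<forall>x\<in>K. \<forall>y\<in>K. x \<noteq> y \<longrightarrow> c \<le> gap E V x y)"

text \<open>
  What \<open>\<chi>\<close>-boundedness of the class means for one tournament: a bound for the cliques of backedges
  in a single ordering of a subset already bounds the dichromatic number of that subset.
\<close>
definition order_bounded :: "(nat \<Rightarrow> nat) \<Rightarrow> 'a rel \<Rightarrow> 'a set \<Rightarrow> bool" where
  "order_bounded h E V \<longleftrightarrow> (\<forall>X\<subseteq>V. \<forall>R W. linear_order_on X R \<longrightarrow>
     (\<forall>K\<subseteq>X. backclique E R K \<longrightarrow> card K \<le> W) \<longrightarrow> chi E X \<le> h W)"

text \<open>
  A linked set \<open>S\<close> of maximum size cuts \<open>U\<close> into what comes before some vertex of \<open>S\<close> (the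
  interval from the latter to the former is small) and what comes after some vertex of \<open>S\<close>, as a
  maximum antichain does in a partial order.
\<close>
definition right_of :: "'a rel \<Rightarrow> 'a set \<Rightarrow> nat \<Rightarrow> 'a set \<Rightarrow> 'a set \<Rightarrow> 'a set" where
  "right_of E V c U S = {b\<in>U. \<exists>p\<in>S. gap E V b p < c}"

definition left_of :: "'a rel \<Rightarrow> 'a set \<Rightarrow> nat \<Rightarrow> 'a set \<Rightarrow> 'a set \<Rightarrow> 'a set" where
  "left_of E V c U S = {a\<in>U. \<exists>p\<in>S. gap E V p a < c}"

definition precedes :: "'a rel \<Rightarrow> 'a set \<Rightarrow> nat \<Rightarrow> 'a set \<Rightarrow> 'a set \<Rightarrow> bool" where
  "precedes E V g S S' \<longleftrightarrow> (\<forall>p\<in>S. \<forall>p'\<in>S'. g \<le> gap E V p p')"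

text \<open>
  Otherwise \<open>insert b S\<close> would be a linked set that is too large.
\<close>
lemma left_or_right:
  assumes V: "tournament_on E V" and U: "U \<subseteq> V" and c: "1 \<le> c" "c \<le> c'"
    and max: "\<And>K. \<lbrakk>K \<subseteq> U; linked E V c K\<rbrakk> \<Longrightarrow> card K \<le> card S"
    and S: "S \<subseteq> U" "linked E V c' S" and b: "b \<in> U"
  shows "b \<in> left_of E V c U S \<or> b \<in> right_of E V c U S"
proof (rule ccontr)
  assume "\<not> ?thesis"
  then have no: "c \<le> gap E V b p" "c \<le> gap E V p b" if "p \<in> S" for p
    using that b by (auto simp: left_of_def right_of_def not_less[symmetric])
  have "b \<notin> S" using no(1)[of b] gap_refl[OF V, of b] c U b by auto
  moreover have "finite S" using S U tournament_onD(1)[OF V] by (meson finite_subset)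
  moreover have "linked E V c (insert b S)"
    using no S(2) c(2) unfolding linked_def by (auto intro: order_trans)
  ultimately show False using max[of "insert b S"] S b by simp
qed

text \<open>
  A vertex left of one cut and a vertex right of a later cut inherit the distance of the cuts.
\<close>
lemma far_across_cuts:
  assumes V: "tournament_on E V" and U: "U \<subseteq> V" and S: "S \<subseteq> U" "S' \<subseteq> U"
    and p: "precedes E V g S S'" and a: "a \<in> left_of E V c U S" and b: "b \<in> right_of E V c U S'"
  shows "g \<le> gap E V a b + 2 * c"
proof -
  obtain p p' where p: "p \<in> S" "gap E V p a < c" "p' \<in> S'" "gap E V b p' < c" "g \<le> gap E V p p'"
    and ab: "a \<in> U" "b \<in> U"
    using a b p unfolding left_of_def right_of_def precedes_def by blast
  have m: "p \<in> V" "p' \<in> V" "a \<in> V" "b \<in> V" using S U p ab by auto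
  have "gap E V p p' \<le> gap E V p a + gap E V a p' + 1" by (rule gap_triangle[OF V m(1,3,2)])
  moreover have "gap E V a p' \<le> gap E V a b + gap E V b p' + 1" by (rule gap_triangle[OF V m(3,4,2)])
  ultimately show ?thesis using p by linarith
qed

text \<open>
  By the previous lemma no vertex is left of a cut and right of a later one, so the right
  sides shrink strictly along a chain; they lose the vertices of the cut that is passed.
\<close>
lemma length_chain_of_cuts_le:
  assumes V: "tournament_on E V" and U: "U \<subseteq> V" and c: "1 \<le> c" "2 * c < g"
    and cov: "\<And>S b. \<lbrakk>S \<in> \<S>; b \<in> U\<rbrakk> \<Longrightarrow> b \<in> left_of E V c U S \<or> b \<in> right_of E V c U S"
    and S: "\<And>S. S \<in> \<S> \<Longrightarrow> S \<subseteq> U \<and> S \<noteq> {}"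
    and xs: "set xs \<subseteq> \<S>" "successively (precedes E V g) xs"
  shows "length xs \<le> card U"
proof -
  have finU: "finite U" using U tournament_onD(1)[OF V] by (rule finite_subset)
  have self: "p \<in> left_of E V c U S" "p \<in> right_of E V c U S" if "p \<in> S" "S \<in> \<S>" for p S
    using that S[OF that(2)] gap_refl[OF V, of p] U c
    by (auto simp: left_of_def right_of_def intro!: bexI[of _ p])
  have sub: "right_of E V c U S \<subseteq> U" for S by (auto simp: right_of_def)
  have disj: False if "a \<in> left_of E V c U S" "a \<in> right_of E V c U S'" "S \<in> \<S>" "S' \<in> \<S>" "precedes E V g S S'" for a S S'
  proof -
    have "a \<in> V" using that(1) U by (auto simp: left_of_def)
    then show False
      using far_across_cuts[OF V U _ _ that(5,1,2)] S that gap_refl[OF V] c by fastforce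
  qed
  have "xs \<noteq> [] \<longrightarrow> length xs \<le> card (right_of E V c U (hd xs))"
    using xs
  proof (induction xs)
    case (Cons S xs)
    have SS: "S \<in> \<S>" using Cons.prems by simp
    obtain p where p: "p \<in> S" using S[OF SS] by blast
    show ?case
    proof (cases xs)
      case Nil
      then show ?thesis using self(2)[OF p SS] finU finite_subset[OF sub]
        by (auto simp: Suc_le_eq card_gt_0_iff)
    next
      case (Cons S' ys)
      have S': "S' \<in> \<S>" "precedes E V g S S'" using Cons.prems Cons by auto
      have "right_of E V c U S' \<subset> right_of E V c U S"
        using disj[OF _ _ SS S'] cov[OF SS] self[OF p SS] sub by blast
      then have "card (right_of E V c U S') < card (right_of E V c U S)"
        using finite_subset[OF sub finU] by (rule psubset_card_mono[rotated])
      then show ?thesis using Cons Cons.IH Cons.prems by auto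
    qed
  qed simp
  then show ?thesis
    using card_mono[OF finU sub] by (cases "xs = []") (auto intro: order_trans)
qed

text \<open>
  A vertex \<open>p\<close> right of \<open>S\<close> comes after some \<open>s0 \<in> S\<close>. If it were at distance less than \<open>g\<close> from
  another \<open>s \<in> S\<close>, the triangle inequality would make \<open>s\<close> and \<open>s0\<close> too close for a linked set; so the
  only obstacle is the ball around \<open>s0\<close> itself.
\<close>
lemma cut_precedes_set:
  assumes V: "tournament_on E V" and U: "U \<subseteq> V" and S: "S \<subseteq> U" "linked E V (g + c) S"
    and T: "T \<subseteq> right_of E V c U S" "T \<inter> (\<Union>s\<in>S. near E V g s) = {}" and c: "c \<le> g"
  shows "precedes E V g S T"
  unfolding precedes_def
proof (intro ballI, rule ccontr)
  fix s p assume *: "s \<in> S" "p \<in> T" "\<not> g \<le> gap E V s p"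
  obtain s0 where s0: "s0 \<in> S" "gap E V p s0 < c" using T * by (auto simp: right_of_def)
  have m: "s \<in> V" "p \<in> V" "s0 \<in> V" using * s0 S T U by (auto simp: right_of_def)
  show False
  proof (cases "s = s0")
    case True
    then have "p \<in> near E V g s" using m * s0 c by (simp add: near_def)
    then show False using T * by blast
  next
    case False
    then have "g + c \<le> gap E V s s0" using S * s0 by (simp add: linked_def)
    then show False using gap_triangle[OF V m] * s0 by linarith
  qed
qed

lemma set_precedes_cut:
  assumes V: "tournament_on E V" and U: "U \<subseteq> V" and S: "S \<subseteq> U" "linked E V (g + c) S"
    and T: "T \<subseteq> left_of E V c U S" "T \<inter> (\<Union>s\<in>S. near E V g s) = {}" and c: "c \<le> g"
  shows "precedes E V g T S"
  unfolding precedes_def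
proof (intro ballI, rule ccontr)
  fix p s assume *: "p \<in> T" "s \<in> S" "\<not> g \<le> gap E V p s"
  obtain s0 where s0: "s0 \<in> S" "gap E V s0 p < c" using T * by (auto simp: left_of_def)
  have m: "s0 \<in> V" "p \<in> V" "s \<in> V" using * s0 S T U by (auto simp: left_of_def)
  show False
  proof (cases "s = s0")
    case True
    then have "p \<in> near E V g s" using m * s0 c by (simp add: near_def)
    then show False using T * by blast
  next
    case False
    then have "g + c \<le> gap E V s0 s" using S * s0 by (simp add: linked_def)
    then show False using gap_triangle[OF V m] * s0 by linarith
  qed
qed

text \<open>
  Cuts are linked sets of the maximum size \<open>n + 1\<close>, but at the larger scale \<open>g + c\<close>,
  so that a vertex cannot be close to two vertices of a cut. Take a longest
  chain of cuts in which consecutive ones are at distance at least \<open>g\<close>, and let the level of a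
  vertex be the number of initial cuts that it is right of. Vertices whose levels differ by at least
  two are separated by two consecutive cuts and hence are far apart; with \<open>g = 3 * c\<close> the distance
  \<open>c\<close> remains after the loss in \<open>far_across_cuts\<close>. A single level lies between two
  consecutive cuts; outside the balls around these cuts it contains no further cut, because such
  a cut could be inserted into the chain, so there the bound \<open>Q\<close> for smaller linked sets applies.
  Thus all levels have bounded dichromatic number, and the ordering by levels has small cliques of
  backedges.
\<close>
lemma chi_le_if_linked_sets_bounded_step:
  fixes E :: "'a rel" and c g \<kappa> :: nat
  defines "\<beta> \<equiv> 1 + 2 * (\<kappa> * (g + 1))"
  assumes V: "tournament_on E V" and dom: "small_dominating \<kappa> E V" and ord: "order_bounded h E V"
    and heavy: "\<And>K. \<lbrakk>K \<subseteq> V; heavy E V c0 K\<rbrakk> \<Longrightarrow> card K \<le> r"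
    and c: "1 \<le> c" "c0 \<le> c" and g: "g = 3 * c"
    and U: "U \<subseteq> V" and free: "\<And>K. \<lbrakk>K \<subseteq> U; linked E V c K\<rbrakk> \<Longrightarrow> card K \<le> Suc n"
    and IH: "\<And>X. \<lbrakk>X \<subseteq> V; \<And>K. \<lbrakk>K \<subseteq> X; linked E V (g + c) K\<rbrakk> \<Longrightarrow> card K \<le> n\<rbrakk> \<Longrightarrow> chi E X \<le> Q"
  shows "chi E U \<le> h (2 * (Q + 2 * (Suc n * \<beta>)) * r)"
proof -
  have TU: "tournament_on E U" using V U by (rule tournament_on_subset)
  define \<S> where "\<S> = {S. S \<subseteq> U \<and> card S = Suc n \<and> linked E V (g + c) S}"
  have cut: "S \<subseteq> U" "card S = Suc n" "linked E V (g + c) S" "finite S" "S \<noteq> {}" if "S \<in> \<S>" for S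
    using that by (auto simp: \<S>_def intro: card_ge_0_finite)
  have cov: "b \<in> left_of E V c U S \<or> b \<in> right_of E V c U S" if "S \<in> \<S>" "b \<in> U" for S b
    using left_or_right[OF V U c(1) _ _ cut(1,3)[OF that(1)] that(2)] free cut(2)[OF that(1)] by simp
  let ?chain = "\<lambda>xs. set xs \<subseteq> \<S> \<and> successively (precedes E V g) xs"
  have len: "length xs \<le> card U" if "?chain xs" for xs
    using length_chain_of_cuts_le[OF V U c(1) _ cov _ _ conjunct2[OF that]] cut that c g by auto
  have "\<exists>xs. ?chain xs \<and> (\<forall>ys. ?chain ys \<longrightarrow> length ys \<le> length xs)"
    by (rule ex_has_greatest_nat[of ?chain "[]" length "Suc (card U)"]) (use len in \<open>auto simp: less_Suc_eq_le\<close>)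
  then obtain xs where xs: "set xs \<subseteq> \<S>" "successively (precedes E V g) xs"
    and longest: "\<And>ys. \<lbrakk>set ys \<subseteq> \<S>; successively (precedes E V g) ys\<rbrakk> \<Longrightarrow> length ys \<le> length xs"
    by blast
  have xs_nth: "xs ! i \<in> \<S>" if "i < length xs" for i using that xs(1) by auto
  define lev where "lev = (\<lambda>a. length (takeWhile (\<lambda>S. a \<in> right_of E V c U S) xs))"
  have lev_right: "a \<in> right_of E V c U (xs ! i)" if "i < lev a" for a i
    using that nth_mem[of i "takeWhile (\<lambda>S. a \<in> right_of E V c U S) xs"]
    unfolding lev_def by (auto simp: takeWhile_nth dest: set_takeWhileD)
  have lev_left: "a \<in> left_of E V c U (xs ! lev a)" if "lev a < length xs" "a \<in> U" for a
    using that cov[OF xs_nth that(2)] nth_length_takeWhile[of "\<lambda>S. a \<in> right_of E V c U S" xs]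
    unfolding lev_def by blast
  have lev_le: "lev a \<le> length xs" for a unfolding lev_def by (rule length_takeWhile_le)
  have far: "c0 \<le> gap E V a b" if "a \<in> U" "b \<in> U" "lev a + 2 \<le> lev b" for a b
  proof -
    let ?i = "lev a"
    have i: "Suc ?i < lev b" "Suc ?i < length xs" "?i < length xs" using that lev_le[of b] by auto
    have "precedes E V g (xs ! ?i) (xs ! Suc ?i)"
      using xs(2) i(2) by (rule successively_nth)
    then have "g \<le> gap E V a b + 2 * c"
      by (rule far_across_cuts[OF V U cut(1)[OF xs_nth[OF i(3)]] cut(1)[OF xs_nth[OF i(2)]] _
        lev_left[OF i(3) that(1)] lev_right[OF i(1)]])
    then show ?thesis using c g by linarith
  qed
  have near_bound: "chi E (\<Union>s\<in>S. near E V g s) \<le> Suc n * \<beta>" if "S \<in> \<S>" for S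
    using chi_UN[OF V cut(4)[OF that], of "near E V g" \<beta>] chi_near_le[OF V dom] cut(1,2)[OF that] U
    unfolding \<beta>_def by (auto simp: near_def subset_iff)
  have level: "chi E {a\<in>U. lev a = i} \<le> Q + 2 * (Suc n * \<beta>)" for i
  proof (cases "i \<le> length xs")
    case False
    then have "{a\<in>U. lev a = i} = {}" using lev_le by (metis (mono_tags, lifting) Collect_empty_eq)
    then show ?thesis by (simp only: chi_empty le0)
  next
    case True
    define N1 where "N1 = (if i = 0 then {} else \<Union>s\<in>xs ! (i - 1). near E V g s)"
    define N2 where "N2 = (if i < length xs then \<Union>s\<in>xs ! i. near E V g s else {})"
    define Y where "Y = {a\<in>U. lev a = i} - (N1 \<union> N2)"
    have NV: "N1 \<subseteq> V" "N2 \<subseteq> V" "Y \<subseteq> V" "Y \<subseteq> U"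
      using U by (auto simp: N1_def N2_def near_def Y_def split: if_splits)
    have N1: "chi E N1 \<le> Suc n * \<beta>"
    proof (cases "i = 0")
      case False
      then show ?thesis using near_bound[OF xs_nth, of "i - 1"] True by (simp add: N1_def)
    qed (simp add: N1_def)
    have N2: "chi E N2 \<le> Suc n * \<beta>"
    proof (cases "i < length xs")
      case True
      then show ?thesis using near_bound[OF xs_nth, of i] by (simp add: N2_def)
    qed (simp add: N2_def)
    have Y: "chi E Y \<le> Q"
    proof (rule IH[OF NV(3)], rule ccontr)
      fix K assume K: "K \<subseteq> Y" "linked E V (g + c) K" "\<not> card K \<le> n"
      then obtain T where T: "T \<subseteq> K" "card T = Suc n"
        by (meson not_less_eq_eq obtain_subset_with_card_n)
      have TY: "T \<subseteq> Y" using T K by blast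
      have "linked E V (g + c) T" using T(1) K(2) unfolding linked_def by blast
      then have TS: "T \<in> \<S>" using T(2) TY NV(4) unfolding \<S>_def by blast
      have before: "precedes E V g (xs ! (i - 1)) T" if "i \<noteq> 0"
      proof -
        have i: "i - 1 < length xs" using that True by simp
        have "T \<subseteq> right_of E V c U (xs ! (i - 1))"
          using lev_right[of "i - 1"] TY that by (auto simp: Y_def)
        moreover have "T \<inter> (\<Union>s\<in>xs ! (i - 1). near E V g s) = {}"
          using TY that by (auto simp: Y_def N1_def)
        ultimately show ?thesis
          using cut_precedes_set[OF V U cut(1,3)[OF xs_nth[OF i]], of T] g by simp
      qed
      have after: "precedes E V g T (xs ! i)" if i: "i < length xs"
      proof -
        have "T \<subseteq> left_of E V c U (xs ! i)"
          using lev_left TY i by (auto simp: Y_def)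
        moreover have "T \<inter> (\<Union>s\<in>xs ! i. near E V g s) = {}"
          using TY i by (auto simp: Y_def N2_def)
        ultimately show ?thesis
          using set_precedes_cut[OF V U cut(1,3)[OF xs_nth[OF i]], of T] g by simp
      qed
      \<comment> \<open>the chain that results from inserting \<open>T\<close> between its neighbouring cuts\<close>
      let ?ys = "take i xs @ [T] @ drop i xs"
      have "successively (precedes E V g) (take i xs @ drop i xs)" using xs(2) by simp
      then have "successively (precedes E V g) (take i xs)" "successively (precedes E V g) (drop i xs)"
        unfolding successively_append_iff by auto
      moreover have "precedes E V g (last (take i xs)) T" if "take i xs \<noteq> []"
        using that before True by (simp add: last_conv_nth)
      moreover have "precedes E V g T (hd (drop i xs))" if "drop i xs \<noteq> []"
        using that after hd_drop_conv_nth[of i xs] by simp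
      ultimately have "successively (precedes E V g) ?ys"
        unfolding successively_append_iff successively_Cons by (simp del: take_eq_Nil drop_eq_Nil) blast
      moreover have "set ?ys \<subseteq> \<S>"
        using xs(1) TS set_take_subset[of i xs] set_drop_subset[of i xs] by auto
      ultimately have "length ?ys \<le> length xs" using longest by blast
      then show False by simp
    qed
    have "{a\<in>U. lev a = i} \<subseteq> Y \<union> (N1 \<union> N2)" by (auto simp: Y_def)
    then have "chi E {a\<in>U. lev a = i} \<le> chi E (Y \<union> (N1 \<union> N2))"
      using NV by (intro chi_mono[OF tournament_on_subset[OF V]]) auto
    also have "\<dots> \<le> chi E Y + chi E (N1 \<union> N2)" using NV by (intro chi_Un[OF V]) auto
    also have "chi E (N1 \<union> N2) \<le> chi E N1 + chi E N2" using NV by (intro chi_Un[OF V]) auto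
    finally show ?thesis using Y N1 N2 by linarith
  qed
  obtain R where "linear_order_on U R"
    "\<forall>K\<subseteq>U. backclique E R K \<longrightarrow> card K \<le> 2 * (Q + 2 * (Suc n * \<beta>)) * r"
    using order_with_small_backcliques[OF TU level far, of r] heavy subset_trans[OF _ U] by blast
  then show ?thesis using ord U unfolding order_bounded_def by blast
qed

section \<open>Large dichromatic number forces a bounded obstruction\<close>
definition tame :: "nat \<Rightarrow> (nat \<Rightarrow> nat) \<Rightarrow> 'a rel \<Rightarrow> 'a set \<Rightarrow> bool" where
  "tame \<kappa> h E V \<longleftrightarrow> tournament_on E V \<and> small_dominating \<kappa> E V \<and> order_bounded h E V"

lemma tame_subset:
  assumes V: "tame \<kappa> h E V" and X: "X \<subseteq> V"
  shows "tame \<kappa> h E X"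
proof -
  have sub: "Y \<subseteq> X \<Longrightarrow> Y \<subseteq> V" for Y using X by blast
  have "small_dominating \<kappa> E X" using V sub by (simp add: tame_def small_dominating_def)
  moreover have "order_bounded h E X" using V sub by (simp add: tame_def order_bounded_def)
  ultimately show ?thesis using V tournament_on_subset[OF _ X] by (simp add: tame_def)
qed

text \<open>
  Induction on the size of linked sets. The scale \<open>c\<close> varies in the induction because each step
  replaces it by a larger one, at which the linked sets that serve as cuts are sought.
\<close>
lemma chi_le_if_linked_sets_bounded:
  assumes "max 1 c0 \<le> c"
  shows "\<exists>Q. \<forall>E (V :: 'a set) U. tame \<kappa> h E V \<longrightarrow> (\<forall>K\<subseteq>V. heavy E V c0 K \<longrightarrow> card K \<le> r) \<longrightarrow>
     U \<subseteq> V \<longrightarrow> (\<forall>K\<subseteq>U. linked E V c K \<longrightarrow> card K \<le> n) \<longrightarrow> chi E U \<le> Q"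
  using assms
proof (induction n arbitrary: c)
  case 0
  show ?case
  proof (intro allI impI exI[of _ 0])
    fix E and V U :: "'a set"
    assume free: "\<forall>K\<subseteq>U. linked E V c K \<longrightarrow> card K \<le> 0"
    have "u \<notin> U" for u
      using free[rule_format, of "{u}"] by (auto simp: linked_def)
    then have "U = {}" by blast
    then show "chi E U \<le> 0" by simp
  qed
next
  case (Suc n)
  let ?g = "3 * c"
  have "max 1 c0 \<le> ?g + c" using Suc.prems by simp
  from Suc.IH[OF this] obtain Q where Q: "\<forall>E (V :: 'a set) U. tame \<kappa> h E V \<longrightarrow> (\<forall>K\<subseteq>V. heavy E V c0 K \<longrightarrow> card K \<le> r) \<longrightarrow>
     U \<subseteq> V \<longrightarrow> (\<forall>K\<subseteq>U. linked E V (?g + c) K \<longrightarrow> card K \<le> n) \<longrightarrow> chi E U \<le> Q" ..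
  show ?case
  proof (intro exI allI impI)
    fix E and V U :: "'a set"
    assume V: "tame \<kappa> h E V" and heavy: "\<forall>K\<subseteq>V. heavy E V c0 K \<longrightarrow> card K \<le> r"
      and U: "U \<subseteq> V" and free: "\<forall>K\<subseteq>U. linked E V c K \<longrightarrow> card K \<le> Suc n"
    note V' = V[unfolded tame_def]
    show "chi E U \<le> h (2 * (Q + 2 * (Suc n * (1 + 2 * (\<kappa> * (?g + 1))))) * r)"
    proof (rule chi_le_if_linked_sets_bounded_step[of E V \<kappa> h c0 r c ?g U n Q])
      show "chi E X \<le> Q" if "X \<subseteq> V" "\<And>K. \<lbrakk>K \<subseteq> X; linked E V (?g + c) K\<rbrakk> \<Longrightarrow> card K \<le> n" for X
        by (rule Q[rule_format, OF V]) (use heavy that in simp_all)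
    qed (use V' heavy U free Suc.prems in simp_all)
  qed
qed

text \<open>
  Induction on \<open>r\<close>. At scale \<open>c\<close>, every interval of an arc in a heavy set contains a bounded obstruction
  for \<open>r\<close>; so a heavy set of size \<open>r + 1\<close> yields one for \<open>r + 1\<close>. If there is no such heavy set, then
  there is no linked set of size \<open>r + 1\<close> either, and the dichromatic number is bounded.
\<close>
lemma large_chi_imp_finite_obstruction:
  "\<exists>c n. \<forall>E (V :: 'a set). tame \<kappa> h E V \<longrightarrow> c \<le> chi E V \<longrightarrow> (\<exists>S\<subseteq>V. card S \<le> n \<and> r \<le> chi E S)"
proof (induction r)
  case 0
  show ?case by (intro exI[of _ 0] allI impI exI[of _ "{}"]) simp
next
  case (Suc r)
  then obtain c n where
    IH: "\<forall>E (V :: 'a set). tame \<kappa> h E V \<longrightarrow> c \<le> chi E V \<longrightarrow> (\<exists>S\<subseteq>V. card S \<le> n \<and> r \<le> chi E S)"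
    by (elim exE)
  let ?c = "max 1 c"
  from chi_le_if_linked_sets_bounded[OF order_refl, where ?c0.0 = c and \<kappa> = \<kappa> and h = h and r = r and n = r] obtain Q where
    Q: "\<forall>E (V :: 'a set) U. tame \<kappa> h E V \<longrightarrow> (\<forall>K\<subseteq>V. heavy E V c K \<longrightarrow> card K \<le> r) \<longrightarrow>
     U \<subseteq> V \<longrightarrow> (\<forall>K\<subseteq>U. linked E V ?c K \<longrightarrow> card K \<le> r) \<longrightarrow> chi E U \<le> Q" ..
  have "\<exists>S\<subseteq>V. card S \<le> Suc r + Suc r ^ 2 * n \<and> Suc r \<le> chi E S"
    if V: "tame \<kappa> h E V" and large: "Suc Q \<le> chi E V" for E and V :: "'a set"
  proof (cases "\<forall>K\<subseteq>V. heavy E V c K \<longrightarrow> card K \<le> r")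
    case True
    have T: "tournament_on E V" using V by (simp add: tame_def)
    have "heavy E V c K" if "K \<subseteq> V" "linked E V ?c K" for K
      unfolding heavy_def
    proof (intro ballI impI)
      fix x y assume xy: "x \<in> K" "y \<in> K" "(y, x) \<in> E"
      then have "x \<noteq> y" using tournament_onD(2)[OF T] that(1) by blast
      then show "c \<le> gap E V x y" using xy that(2) by (simp add: linked_def)
    qed
    then have "chi E V \<le> Q" using True by (intro Q[rule_format, OF V]) auto
    then show ?thesis using large by simp
  next
    case False
    then obtain K where K: "K \<subseteq> V" "heavy E V c K" "Suc r \<le> card K" by (auto simp: not_le)
    then obtain K' where K': "K' \<subseteq> K" "card K' = Suc r" by (meson obtain_subset_with_card_n)
    show ?thesis
    proof (rule heavy_clique_imp_finite_obstruction)
      show "tournament_on E V" using V by (simp add: tame_def)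
      show "K' \<subseteq> V" "card K' = Suc r" using K' K by auto
      show "heavy E V c K'" using K' K unfolding heavy_def by blast
      show "\<exists>S\<subseteq>X. card S \<le> n \<and> r \<le> chi E S" if "X \<subseteq> V" "c \<le> chi E X" for X
        by (rule IH[rule_format, OF tame_subset[OF V that(1)] that(2)])
    qed
  qed
  then show ?case by (intro exI[of _ "Suc Q"] exI[of _ "Suc r + Suc r ^ 2 * n"] allI impI) simp
qed

section \<open>The complete pair\<close>

text \<open>
  Without a complete pair, a set of bounded size and dichromatic number at least \<open>2 * t\<close> is impossible
  when \<open>V\<close> is large. Its absence first gives small dominating and absorbing sets, and then
  these, with the bound from orderings, produce it after all.
\<close>
lemma order_bounded_imp_complete_pair:
  "\<exists>N. \<forall>E (V :: 'a set). tournament_on E V \<longrightarrow> order_bounded h E V \<longrightarrow> N \<le> chi E V \<longrightarrow>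
     (\<exists>A B. A \<subseteq> V \<and> B \<subseteq> V \<and> (\<forall>a\<in>A. \<forall>b\<in>B. (a, b) \<in> E) \<and> t \<le> chi E A \<and> t \<le> chi E B)"
proof -
  from large_domination_imp_finite_obstruction[of "2 * t"] obtain K l where
    Kl: "\<forall>E (V :: 'a set). tournament_on E V \<longrightarrow> (\<forall>D. dominates E D V \<longrightarrow> K \<le> card D) \<longrightarrow>
      (\<exists>S\<subseteq>V. card S \<le> l \<and> 2 * t \<le> chi E S)"
    by (elim exE)
  from large_chi_imp_finite_obstruction[of K h "2 * t"] obtain c n where
    cn: "\<forall>E (V :: 'a set). tame K h E V \<longrightarrow> c \<le> chi E V \<longrightarrow> (\<exists>S\<subseteq>V. card S \<le> n \<and> 2 * t \<le> chi E S)"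
    by (elim exE)
  define m where "m = max l n"
  have "\<exists>A B. A \<subseteq> V \<and> B \<subseteq> V \<and> (\<forall>a\<in>A. \<forall>b\<in>B. (a, b) \<in> E) \<and> t \<le> chi E A \<and> t \<le> chi E B"
    if V: "tournament_on E V" "order_bounded h E V" and large: "max c (Suc (m + 2 ^ m * t)) \<le> chi E V"
    for E and V :: "'a set"
  proof (rule ccontr)
    assume none: "\<not> ?thesis"
    have no: False if "S \<subseteq> V" "card S \<le> m" "2 * t \<le> chi E S" for S
    proof -
      have "chi E V \<le> m + 2 ^ m * t"
      proof (rule finite_obstruction_bounds_chi[OF V(1) _ that])
        fix A B assume AB: "A \<subseteq> V" "B \<subseteq> V" "\<And>a b. \<lbrakk>a \<in> A; b \<in> B\<rbrakk> \<Longrightarrow> (a, b) \<in> E"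
        show "chi E A < t \<or> chi E B < t"
        proof (rule ccontr)
          assume "\<not> ?thesis"
          then have "t \<le> chi E A" "t \<le> chi E B" by auto
          with AB show False using none by blast
        qed
      qed
      then show False using large by simp
    qed
    have dom: "\<exists>D. dominates F D Y \<and> card D \<le> K" if Y: "Y \<subseteq> V" and F: "F = E \<or> F = E\<inverse>" for F Y
    proof (rule ccontr)
      assume none: "\<not> ?thesis"
      have D: "\<forall>D. dominates F D Y \<longrightarrow> K \<le> card D"
      proof (intro allI impI)
        fix D assume "dominates F D Y"
        then show "K \<le> card D" using none by (cases "card D \<le> K") auto
      qed
      have "tournament_on F Y"
        using tournament_on_subset[OF V(1) Y] F tournament_on_converse by auto
      from Kl[rule_format, OF this D[rule_format]]
      obtain S where S: "S \<subseteq> Y" "card S \<le> l" "2 * t \<le> chi F S" by blast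
      have "chi F S = chi E S" using F chi_converse by auto
      then show False using no[OF subset_trans[OF S(1) Y], unfolded m_def] S(2,3) by (auto simp: le_max_iff_disj)
    qed
    have "small_dominating K E V"
      unfolding small_dominating_def
      by (intro allI impI conjI; rule dom; simp)
    then have "tame K h E V" using V by (simp add: tame_def)
    moreover have "c \<le> chi E V" using large by simp
    ultimately obtain S where S: "S \<subseteq> V" "card S \<le> n" "2 * t \<le> chi E S"
      using cn[rule_format, of E V] by blast
    then show False using no[OF S(1), unfolded m_def] by (auto simp: le_max_iff_disj)
  qed
  then show ?thesis by (intro exI[of _ "max c (Suc (m + 2 ^ m * t))"] allI impI) simp
qed

section \<open>Back to digraphs\<close>
lemma tournament_imp_tournament_on: "tournament T \<Longrightarrow> tournament_on (parcs T) (pverts T)"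
  unfolding tournament_def oriented_digraph_def tournament_on_def
  using pair_digraph.axioms pair_fin_digraph.pair_finite_verts pair_loopfree_digraph.pair_no_loops
  by fastforce

definition induced :: "'a pair_pre_digraph \<Rightarrow> 'a set \<Rightarrow> 'a pair_pre_digraph" where
  "induced T X = \<lparr>pverts = X, parcs = Restr (parcs T) X\<rparr>"

lemma subtournament_induced:
  assumes T: "tournament T" and X: "X \<subseteq> pverts T"
  shows "subtournament (induced T X) T"
proof -
  have D: "pair_digraph T" using T by (simp add: tournament_def oriented_digraph_def)
  interpret pair_digraph T by (rule D)
  have "pair_digraph (induced T X)"
    by unfold_locales
      (use X pair_finite_verts pair_finite_arcs pair_no_loops in \<open>auto simp: induced_def intro: finite_subset\<close>)
  then have "tournament (induced T X)"
    using T X unfolding tournament_def oriented_digraph_def by (auto simp: induced_def)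
  moreover have "wf_digraph (with_proj T)" ..
  moreover have "wf_digraph (with_proj (induced T X))"
    using \<open>pair_digraph (induced T X)\<close>
    by (simp add: pair_digraph_def pair_fin_digraph_def wf_digraph_wp_iff)
  ultimately show ?thesis
    using X by (auto simp: subtournament_def subgraph_def induced_def compatible_def)
qed

lemma chi_Restr: "chi (Restr E X) X = chi E X"
proof -
  have "coloring (Restr E X) k X f \<longleftrightarrow> coloring E k X f" for k f
    unfolding coloring_def by auto
  then show ?thesis by (simp add: chi_def colorable_def)
qed

text \<open>
  A class without directed triangles induces a transitive, hence acyclic, relation. Empty colour
  classes disappear in the passage from colourings to partitions, so that only the minima over all
  numbers of parts agree.
\<close>
lemma dichromatic_number_eq_chi:
  assumes T: "tournament D"
  shows "dichromatic_number D = chi (parcs D) (pverts D)"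
proof -
  let ?V = "pverts D" and ?E = "parcs D"
  let ?P = "\<lambda>k P. partition_on ?V P \<and> finite P \<and> card P = k \<and> (\<forall>X \<in> P. acyclic (Restr ?E X))"
  have V: "tournament_on ?E ?V" by (rule tournament_imp_tournament_on[OF T])
  have color_to_part: "\<exists>l\<le>k. \<exists>P. ?P l P" if f: "coloring ?E k ?V f" for k f
  proof -
    let ?cl = "\<lambda>i. {x\<in>?V. f x = i}"
    define P where "P = ?cl ` (f ` ?V)"
    have "partition_on ?V P" unfolding P_def partition_on_def disjoint_def by auto
    moreover have fin: "finite (f ` ?V)" using tournament_onD(1)[OF V] by simp
    moreover have "card P \<le> card (f ` ?V)" unfolding P_def by (rule card_image_le[OF fin])
    moreover have "card (f ` ?V) \<le> k"
      using card_mono[of "{..<k}" "f ` ?V"] f by (simp add: coloring_def)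
    moreover have "acyclic (Restr ?E X)" if "X \<in> P" for X
    proof -
      obtain i where X: "X = ?cl i" using \<open>X \<in> P\<close> by (auto simp: P_def)
      have "trans (Restr ?E X)"
      proof (rule transI)
        fix x y z assume "(x, y) \<in> Restr ?E X" "(y, z) \<in> Restr ?E X"
        then have *: "(x, y) \<in> ?E" "(y, z) \<in> ?E" "x \<in> ?V" "y \<in> ?V" "z \<in> ?V" "f x = i" "f y = i" "f z = i" "x \<in> X" "z \<in> X"
          by (auto simp: X)
        have "x \<noteq> z" using tournament_onD(3)[OF V *(3,4,1)] *(2) by blast
        moreover have "(z, x) \<notin> ?E" using coloring_triangle[OF f *(3,4,5,1,2)] * by auto
        ultimately show "(x, z) \<in> Restr ?E X" using tournament_onD(4)[OF V *(3,5)] * by blast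
      qed
      then have "(Restr ?E X)\<^sup>+ = Restr ?E X" by (rule trancl_id)
      then show ?thesis using tournament_onD(2)[OF V] by (auto simp: acyclic_def X)
    qed
    ultimately show ?thesis
      by (intro exI[of _ "card P"] conjI exI[of _ P]) (auto simp: P_def)
  qed
  have part_to_color: "colorable ?E k ?V" if P: "?P k P" for k P
  proof -
    obtain g where g: "bij_betw g P {0..<k}" using P ex_bij_betw_finite_nat by blast
    define f where "f = (\<lambda>x. g (THE X. X \<in> P \<and> x \<in> X))"
    have f: "f x = g X" if "X \<in> P" "x \<in> X" for x X
    proof -
      have "(THE X. X \<in> P \<and> x \<in> X) = X"
        using that P by (intro the_equality) (auto simp: partition_on_def disjoint_def)
      then show ?thesis by (simp add: f_def)
    qed
    have cover: "\<exists>X\<in>P. x \<in> X" if "x \<in> ?V" for x using that P by (auto simp: partition_on_def)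
    have "coloring ?E k ?V f"
    proof (rule coloringI)
      show "f x < k" if "x \<in> ?V" for x
      proof -
        from cover[OF that] obtain X where "X \<in> P" "x \<in> X" by blast
        then show ?thesis using f[of X x] bij_betw_apply[OF g, of X] by simp
      qed
      fix x y z
      assume *: "x \<in> ?V" "y \<in> ?V" "z \<in> ?V" "(x, y) \<in> ?E" "(y, z) \<in> ?E" "(z, x) \<in> ?E" "f x = f y" "f y = f z"
      obtain X Y Z where XYZ: "X \<in> P" "x \<in> X" "Y \<in> P" "y \<in> Y" "Z \<in> P" "z \<in> Z"
        using cover[OF *(1)] cover[OF *(2)] cover[OF *(3)] by blast
      have "g X = g Y" "g Y = g Z"
        using *(7,8) f[OF XYZ(1,2)] f[OF XYZ(3,4)] f[OF XYZ(5,6)] by auto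
      then have "X = Y" "Y = Z"
        using inj_onD[OF bij_betw_imp_inj_on[OF g]] XYZ(1,3,5) by blast+
      then have "(x, y) \<in> Restr ?E X" "(y, z) \<in> Restr ?E X" "(z, x) \<in> Restr ?E X" using * XYZ by auto
      then have "(x, x) \<in> (Restr ?E X)\<^sup>+" by (blast intro: trancl_into_trancl)
      then show False using P XYZ by (auto simp: acyclic_def)
    qed
    then show ?thesis unfolding colorable_def by blast
  qed
  obtain f where "coloring ?E (chi ?E ?V) ?V f" using colorable_chi[OF V] unfolding colorable_def by blast
  then obtain l P where l: "l \<le> chi ?E ?V" "?P l P" using color_to_part by blast
  have "\<exists>P. ?P (dichromatic_number D) P"
    unfolding dichromatic_number_def by (rule LeastI_ex) (use l in blast)
  then have "chi ?E ?V \<le> dichromatic_number D" using part_to_color chi_le by blast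
  moreover have "dichromatic_number D \<le> l"
    unfolding dichromatic_number_def by (rule Least_le) (use l in blast)
  ultimately show ?thesis using l by simp
qed

lemma clique_number_le:
  assumes fin: "finite (pverts D)" and R: "linear_order_on (pverts D) R"
    and W: "\<And>K. \<lbrakk>K \<subseteq> pverts D; clique K (backedges D R)\<rbrakk> \<Longrightarrow> card K \<le> W"
  shows "clique_number D \<le> W"
proof -
  let ?S = "{graph_clique_number (pverts D) (backedges D r) | r. linear_order_on (pverts D) r}"
  have "?S \<subseteq> (\<lambda>r. graph_clique_number (pverts D) (backedges D r)) ` Pow (pverts D \<times> pverts D)"
    by (auto simp: order_on_defs)
  then have "finite ?S" by (rule finite_subset) (use fin in simp)
  then have "clique_number D \<le> graph_clique_number (pverts D) (backedges D R)"
    unfolding clique_number_def using R by (intro Min_le) blast+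
  also have "\<dots> \<le> W"
    unfolding graph_clique_number_def
  proof (rule Max.boundedI)
    have "{card K |K. K \<subseteq> pverts D \<and> clique K (backedges D R)} \<subseteq> card ` Pow (pverts D)" by auto
    then show "finite {card K |K. K \<subseteq> pverts D \<and> clique K (backedges D R)}"
      by (rule finite_subset) (use fin in simp)
    have "clique {} (backedges D R)" by (simp add: clique_def)
    then show "{card K |K. K \<subseteq> pverts D \<and> clique K (backedges D R)} \<noteq> {}" by blast
  qed (use W in blast)
  finally show ?thesis .
qed

text \<open>
  Antisymmetry matters: an edge \<open>{x, y}\<close> of the backedge graph does not record which end comes first.
\<close>
lemma clique_imp_backclique:
  assumes "antisym R" "clique K (backedges D R)"
  shows "backclique (parcs D) R K"
  unfolding backclique_def
proof (intro ballI impI)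
  fix x y assume xy: "x \<in> K" "y \<in> K" "(x, y) \<in> R" "x \<noteq> y"
  then have "{x, y} \<in> backedges D R" using assms(2) by (auto simp: clique_def)
  then obtain u v where uv: "{x, y} = {u, v}" "(u, v) \<in> R" "u \<noteq> v" "(v, u) \<in> parcs D"
    by (auto simp: backedges_def)
  then have "u = x \<and> v = y" using xy assms(1) by (auto simp: doubleton_eq_iff dest: antisymD)
  then show "(y, x) \<in> parcs D" using uv by simp
qed

theorem theorem4p18:
  fixes C :: "'a pair_pre_digraph set"
  assumes "tournament_class C"
    and "chi_bounded C"
  shows "big_to_big C"
proof -
  obtain h where h: "mono h" "\<And>D. D \<in> C \<Longrightarrow> dichromatic_number D \<le> h (clique_number D)"
    using assms(2) unfolding chi_bounded_def by blast
  define P where "P = (\<lambda>t N. \<forall>E (V :: 'a set). tournament_on E V \<longrightarrow> order_bounded h E V \<longrightarrow> N \<le> chi E V \<longrightarrow>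
     (\<exists>A B. A \<subseteq> V \<and> B \<subseteq> V \<and> (\<forall>a\<in>A. \<forall>b\<in>B. (a, b) \<in> E) \<and> t \<le> chi E A \<and> t \<le> chi E B))"
  have "\<exists>N. P t N" for t unfolding P_def by (rule order_bounded_imp_complete_pair)
  then obtain N where N: "\<And>t. P t (N t)" by metis
  show ?thesis
    unfolding big_to_big_def
  proof (rule exI[of _ N], intro allI ballI impI)
    fix t T assume T: "T \<in> C" and large: "N t \<le> dichromatic_number T"
    have tT: "tournament T" using T assms(1) unfolding tournament_class_def by blast
    have V: "tournament_on (parcs T) (pverts T)" by (rule tournament_imp_tournament_on[OF tT])
    have sub: "subtournament (induced T X) T" if "X \<subseteq> pverts T" for X
      by (rule subtournament_induced[OF tT that])
    have dich: "dichromatic_number (induced T X) = chi (parcs T) X" if "X \<subseteq> pverts T" for X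
      using dichromatic_number_eq_chi[of "induced T X"] sub[OF that]
      by (simp add: subtournament_def induced_def chi_Restr)
    have "order_bounded h (parcs T) (pverts T)"
      unfolding order_bounded_def
    proof (intro allI impI)
      fix X R W
      assume X: "X \<subseteq> pverts T" and R: "linear_order_on X R"
        and W: "\<forall>K\<subseteq>X. backclique (parcs T) R K \<longrightarrow> card K \<le> W"
      have "clique_number (induced T X) \<le> W"
      proof (rule clique_number_le)
        show "finite (pverts (induced T X))"
          using X tournament_onD(1)[OF V] by (auto simp: induced_def intro: finite_subset)
        show "linear_order_on (pverts (induced T X)) R" using R by (simp add: induced_def)
        fix K assume K: "K \<subseteq> pverts (induced T X)" "clique K (backedges (induced T X) R)"
        have "antisym R" using R by (simp add: order_on_defs)
        then have "backclique (parcs (induced T X)) R K" using K(2) by (rule clique_imp_backclique)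
        then have "backclique (parcs T) R K" by (auto simp: backclique_def induced_def)
        then show "card K \<le> W" using W K(1) by (simp add: induced_def)
      qed
      moreover have "induced T X \<in> C"
        using sub[OF X] T assms(1) unfolding tournament_class_def by blast
      ultimately show "chi (parcs T) X \<le> h W"
        using h(2)[of "induced T X"] monoD[OF h(1), of "clique_number (induced T X)" W] dich[OF X] by simp
    qed
    then obtain A B where AB: "A \<subseteq> pverts T" "B \<subseteq> pverts T" "\<forall>a\<in>A. \<forall>b\<in>B. (a, b) \<in> parcs T"
      "t \<le> chi (parcs T) A" "t \<le> chi (parcs T) B"
      using N[unfolded P_def, rule_format, OF V, of t] large dichromatic_number_eq_chi[OF tT] by auto
    have "A \<inter> B = {}" using AB tournament_onD(2)[OF V] by blast
    then show "\<exists>A B. subtournament A T \<and> subtournament B T \<and> pverts A \<inter> pverts B = {} \<and>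
           dichromatic_number A \<ge> t \<and> dichromatic_number B \<ge> t \<and> complete_to T A B"
      using AB sub dich
      by (intro exI[of _ "induced T A"] exI[of _ "induced T B"]) (simp add: induced_def complete_to_def)
  qed
qed

end
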